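(* Let $T>0$ and $x\in E$. Let $(\Phi_\theta)_{\theta\in\Theta}$ be a family of functions and, for each time step $h>0$, let $(\overline\Phi_\theta)_{\theta\in\Theta}$ be a family of functions (a numerical scheme with time step $h$ approximating $(\Phi_\theta)$) such that there exist positive constants $C_1,C_2$, independent of $h$ and $\theta$, with $$\sup_{t\in[0,T]}|\Phi_\theta(t,\nu_1)-\overline\Phi_\theta(t,\nu_2)|\le e^{C_1T}|\nu_1-\nu_2|+C_2h\qquad\text{for all }\theta\in\Theta,\ (\nu_1,\nu_2)\in\mathbb R^2 .$$ Let $\lambda,Q$ be a jump intensity and transition measure such that, for all $\theta\in\Theta$ and all $A\in\mathcal B(\Theta)$, the functions $\nu\mapsto\lambda(\theta,\nu)$ and $\nu\mapsto Q((\theta,\nu),A)$ are Lipschitz with constants $L_\lambda>0$, $L_Q>0$ respectively, independent of $\theta$. Let $\tilde\lambda,\tilde Q$ be a jump intensity and transition measure depending only on $\theta$, such that there exist positive constants $\rho,\tilde\lambda_{\min},\tilde\lambda_{\max}$ with $\rho\le\tilde Q(i,j)$ and $\tilde\lambda_{\min}\le\tilde\lambda(i)\le\tilde\lambda_{\max}<\lambda^*$ for all $(i,j)\in\Theta^2$. Let $(\tilde x_t)_{t\in[0,T]}$ and $(\underline{\tilde x}_t)_{t\in[0,T]}$ be the PDPs with characteristics $(\Phi,\tilde\lambda,\tilde Q)$ and $(\overline\Phi,\tilde\lambda,\tilde Q)$ respectively, constructed by thinning from the same data $(N_t^* ),(U_k),(V_k)$, with $\tilde x_0=\underline{\tilde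 x}_0=x$, and let $(\tilde R_t)_{t\in[0,T]}$ and $(\underline{\tilde R}_t)_{t\in[0,T]}$ be the associated weights (defined in the context, $\tilde R$ with $\Phi$ and $\underline{\tilde R}$ with $\overline\Phi$). Then for every bounded function $F:E\to\mathbb R$ such that for all $\theta\in\Theta$ the function $\nu\mapsto F(\theta,\nu)$ is $L_F$-Lipschitz ($L_F>0$), there exists a positive constant $\tilde V_1$ independent of the time step $h$ such that $$\mathbb E\left[|F(\underline{\tilde x}_T)\underline{\tilde R}_T-F(\tilde x_T)\tilde R_T|^2\right]\le\tilde V_1h^2 .$$
   Context: Let $\Theta=\{k_1,\dots,k_{|\Theta|}\}$ be a finite or countable set and $E=\Theta\times\mathbb R$; elements of $E$ are written $x=(\theta,\nu)$. A piecewise deterministic process (PDP) is specified by characteristics $(\Phi,\lambda,Q)$: functions $\Phi_\theta:\mathbb R_+\times\mathbb R\to\mathbb R$, $\theta\in\Theta$; a measurable function $\lambda:E\to(0,\infty)$; a transition measure $Q:E\times\mathcal B(E)\to[0,1]$ of the form $Q((\theta,\nu),A\times B)=Q((\theta,\nu),A)\,\delta_\nu(B)$ for $A\in\mathcal B(\Theta)$, $B\in\mathcal B(\mathbb R)$ (only the $\theta$-component jumps). We write $Q(x,\theta')=Q(x,\{\theta'\})$. Standing assumption: there is a constant $\lambda^*<\infty$ with $\lambda(x)\le\lambda^*$ for all $x\in E$. If $\tilde\lambda,\tilde Q$ depend only on $\theta$ we write $\tilde\lambda(\theta)$ and $\tilde Q(\theta,\theta')$ for $\tilde\lambda(\theta,\nu)$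 and $\tilde Q((\theta,\nu),\{\theta'\})$. Data: on a probability space, a homogeneous Poisson process $(N^*_t)_{t\ge0}$ with intensity $\lambda^*$ and jump times $(T^*_k)_{k\ge1}$, $T^*_0=0$; two i.i.d. sequences $(U_k)_{k\ge1}$, $(V_k)_{k\ge1}$ of uniform variables on $[0,1]$, independent of each other and of $(T^*_k)$. Construction by thinning of the PDP with characteristics $(\Phi,\lambda,Q)$: let $a_0=0$, $a_j(x)=\sum_{i=1}^jQ(x,\{k_i\})$ and $H(x,u)=\sum_i k_i\mathbf 1_{a_{i-1}(x)<u\le a_i(x)}$. Start from $(\theta_0,\nu_0)\in E$, $T_0=0$, $\tau_0=0$. For $n\ge1$, $$\tau_n=\inf\{k>\tau_{n-1}:U_k\lambda^*\le\lambda(\theta_{n-1},\Phi_{\theta_{n-1}}(T^*_k-T^*_{\tau_{n-1}},\nu_{n-1}))\},\qquad T_n=T^*_{\tau_n},$$ $$\nu_n=\Phi_{\theta_{n-1}}(T_n-T_{n-1},\nu_{n-1}),\qquad \theta_n=H((\theta_{n-1},\nu_n),V_n).$$ The PDP is $x_t=(\theta_n,\Phi_{\theta_n}(t-T_n,\nu_n))$ for $t\in[T_n,T_{n+1})$, with $x_0=(\theta_0,\nu_0)$, and $N_t=\sum_{n\ge1}\mathbf 1_{T_n\le t}$. For $(\tilde x_t)$ the corresponding objects are denoted $\tilde\tau_n,\tilde T_n,\tilde\theta_n,\tilde\nu_n,\tilde N_t$ (with $\tilde\lambda,\tilde Q$ in place of $\lambda,Q$). Weights: put $\kappa_0=1$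 and $\kappa_\ell=Q((\tilde\theta_{\ell-1},\tilde\nu_\ell),\tilde\theta_\ell)/\tilde Q(\tilde\theta_{\ell-1},\tilde\theta_\ell)$ for $\ell\ge1$. On $\{\tilde N_t=n\}$, for $0\le\ell\le n-1$, $$\tilde Z_\ell=\kappa_\ell\left(\frac{\tilde\lambda(\tilde\theta_\ell)}{\lambda^*}\Big(1-\frac{\tilde\lambda(\tilde\theta_\ell)}{\lambda^*}\Big)^{\tilde\tau_{\ell+1}-\tilde\tau_\ell-1}\right)^{-1}\frac{\lambda(\tilde\theta_\ell,\Phi_{\tilde\theta_\ell}(T^*_{\tilde\tau_{\ell+1}}-T^*_{\tilde\tau_\ell},\tilde\nu_\ell))}{\lambda^*}\prod_{q=\tilde\tau_\ell+1}^{\tilde\tau_{\ell+1}-1}\left(1-\frac{\lambda(\tilde\theta_\ell,\Phi_{\tilde\theta_\ell}(T^*_q-T^*_{\tilde\tau_\ell},\tilde\nu_\ell))}{\lambda^*}\right),$$ and for the last index $$\tilde Z_n=\kappa_n\left(\Big(1-\frac{\tilde\lambda(\tilde\theta_n)}{\lambda^*}\Big)^{N^*_t-\tilde\tau_n}\right)^{-1}\prod_{q=\tilde\tau_n+1}^{N^*_t}\left(1-\frac{\lambda(\tilde\theta_n,\Phi_{\tilde\theta_n}(T^*_q-T^*_{\tilde\tau_n},\tilde\nu_n))}{\lambda^*}\right)$$ (empty products equal $1$). Then $\tilde R_t=\tilde Z_n\prod_{\ell=0}^{n-1}\tilde Z_\ell$ on $\{\tilde N_t=n\}$. The weight $\underline{\tilde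 R}_t$ is defined by the same formulas with $\Phi$ replaced by $\overline\Phi$ and $\tilde\nu_\ell$ replaced by the $\nu$-components $\underline{\tilde\nu}_\ell$ of $(\underline{\tilde x}_t)$ at its jump times (the sequences $\tilde\tau_n$, $\tilde\theta_n$ are common to both processes). *)

theory Defs
  imports "HOL-Probability.Probability"
begin

text \<open>
  The countable set \<open>\<Theta>\<close> is the universe of a countable type \<open>'k\<close>, so that
  \<open>E = \<Theta> \<times> \<real>\<close> is the type \<open>'k \<times> real\<close>.  The enumeration \<open>k\<^sub>1, k\<^sub>2, \<dots>\<close> on which the
  construction by thinning depends is explicit, with \<open>K = |\<Theta>|\<close> possibly infinite.
\<close>

definition enumerates :: "enat \<Rightarrow> (nat \<Rightarrow> 'k::countable) \<Rightarrow> bool" where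
  "enumerates K k \<longleftrightarrow> bij_betw k {i. 1 \<le> i \<and> enat i \<le> K} UNIV"

definition E_space :: "('k::countable \<times> real) measure" where
  "E_space = count_space UNIV \<Otimes>\<^sub>M borel"

record 'k chars =
  flow :: "'k \<Rightarrow> real \<Rightarrow> real \<Rightarrow> real"
  intensity :: "'k \<times> real \<Rightarrow> real"
  kernel :: "'k \<times> real \<Rightarrow> ('k \<times> real) measure"

definition jump_intensity :: "('k::countable \<times> real \<Rightarrow> real) \<Rightarrow> bool" where
  "jump_intensity lam \<longleftrightarrow> lam \<in> borel_measurable E_space \<and> (\<forall>x. 0 < lam x)"

text \<open>\<open>mode_prob Q x A\<close> is \<open>Q(x, A) = Q(x, A \<times> \<real>)\<close> for \<open>A \<subseteq> \<Theta>\<close>.\<close>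

definition mode_prob ::
  "('k \<times> real \<Rightarrow> ('k \<times> real) measure) \<Rightarrow> 'k \<times> real \<Rightarrow> 'k set \<Rightarrow> real" where
  "mode_prob Q x A = measure (Q x) (A \<times> UNIV)"

definition transition_measure ::
  "('k::countable \<times> real \<Rightarrow> ('k \<times> real) measure) \<Rightarrow> bool" where
  "transition_measure Q \<longleftrightarrow>
     Q \<in> measurable E_space (prob_algebra E_space) \<and>
     (\<forall>\<theta> \<nu> A. \<forall>B\<in>sets borel.
        measure (Q (\<theta>, \<nu>)) (A \<times> B) = mode_prob Q (\<theta>, \<nu>) A * indicator B \<nu>)"

definition poisson_process :: "'w measure \<Rightarrow> real \<Rightarrow> (real \<Rightarrow> 'w \<Rightarrow> nat) \<Rightarrow> bool" where
  "poisson_process M r N \<longleftrightarrow>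
     (\<forall>t\<ge>0. N t \<in> measurable M (count_space UNIV)) \<and>
     (\<forall>\<omega>\<in>space M. N 0 \<omega> = 0 \<and> mono_on {0..} (\<lambda>t. N t \<omega>) \<and>
        (\<forall>t\<ge>0. continuous (at_right t) (\<lambda>t. N t \<omega>))) \<and>
     (\<forall>s t. 0 \<le> s \<and> s < t \<longrightarrow>
        distr M (count_space UNIV) (\<lambda>\<omega>. N t \<omega> - N s \<omega>) = measure_pmf (poisson_pmf (r * (t - s)))) \<and>
     (\<forall>ts :: nat \<Rightarrow> real. 0 \<le> ts 0 \<and> strict_mono ts \<longrightarrow>
        prob_space.indep_vars M (\<lambda>_. count_space UNIV)
          (\<lambda>i \<omega>. N (ts (Suc i)) \<omega> - N (ts i) \<omega>) UNIV)"

text \<open>The \<open>j\<close>-th jump time of a counting path; it is \<open>0\<close> for \<open>j = 0\<close>.  The set is nonempty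
  almost surely for a Poisson process with positive intensity.\<close>

definition jump_time :: "(real \<Rightarrow> nat) \<Rightarrow> nat \<Rightarrow> real" where
  "jump_time f j = Inf {t. 0 \<le> t \<and> j \<le> f t}"

definition iid_uniform :: "'w measure \<Rightarrow> (nat \<Rightarrow> 'w \<Rightarrow> real) \<Rightarrow> bool" where
  "iid_uniform M U \<longleftrightarrow>
     prob_space.indep_vars M (\<lambda>_. borel) U {1..} \<and>
     (\<forall>i\<ge>1. distr M borel (U i) = uniform_measure lborel {0..1})"

definition thinning_data ::
  "'w measure \<Rightarrow> real \<Rightarrow> (real \<Rightarrow> 'w \<Rightarrow> nat) \<Rightarrow> (nat \<Rightarrow> 'w \<Rightarrow> real) \<Rightarrow> (nat \<Rightarrow> 'w \<Rightarrow> real) \<Rightarrow> bool" where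
  "thinning_data M lstar N U V \<longleftrightarrow>
     prob_space M \<and> poisson_process M lstar N \<and> iid_uniform M U \<and> iid_uniform M V \<and>
     prob_space.indep_vars M (\<lambda>_. PiM {1..} (\<lambda>_. borel))
       (\<lambda>s \<omega>. \<lambda>i\<in>{1..}. [jump_time (\<lambda>t. N t \<omega>) i, U i \<omega>, V i \<omega>] ! s) {0, 1, 2}"

text \<open>One realisation of the data; the construction below is pathwise.\<close>

record sample =
  pois :: "real \<Rightarrow> nat"
  unifU :: "nat \<Rightarrow> real"
  unifV :: "nat \<Rightarrow> real"

definition realisation ::
  "(real \<Rightarrow> 'w \<Rightarrow> nat) \<Rightarrow> (nat \<Rightarrow> 'w \<Rightarrow> real) \<Rightarrow> (nat \<Rightarrow> 'w \<Rightarrow> real) \<Rightarrow> 'w \<Rightarrow> sample" where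
  "realisation N U V \<omega> =
     \<lparr>pois = (\<lambda>t. N t \<omega>), unifU = (\<lambda>i. U i \<omega>), unifV = (\<lambda>i. V i \<omega>)\<rparr>"

abbreviation Tstar :: "sample \<Rightarrow> nat \<Rightarrow> real" where
  "Tstar s \<equiv> jump_time (pois s)"

definition cumul ::
  "(nat \<Rightarrow> 'k) \<Rightarrow> ('k \<times> real \<Rightarrow> ('k \<times> real) measure) \<Rightarrow> nat \<Rightarrow> 'k \<times> real \<Rightarrow> real" where
  "cumul k Q j x = (\<Sum>i=1..j. mode_prob Q x {k i})"

text \<open>The formula \<open>H(x,u) = \<Sum>\<^sub>i k\<^sub>i 1{a\<^sub>i\<^sub>-\<^sub>1(x) < u \<le> a\<^sub>i(x)}\<close> selects the label of the unique interval
  containing \<open>u\<close>.  If there is no such interval the value is unspecified; for \<open>u\<close> uniform on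
  \<open>[0,1]\<close> this has probability zero.\<close>

definition select ::
  "enat \<Rightarrow> (nat \<Rightarrow> 'k) \<Rightarrow> ('k \<times> real \<Rightarrow> ('k \<times> real) measure) \<Rightarrow> 'k \<times> real \<Rightarrow> real \<Rightarrow> 'k" where
  "select K k Q x u =
     (THE \<theta>. \<exists>i. 1 \<le> i \<and> enat i \<le> K \<and> \<theta> = k i \<and> cumul k Q (i - 1) x < u \<and> u \<le> cumul k Q i x)"

text \<open>The triple \<open>(\<tau>\<^sub>n, \<theta>\<^sub>n, \<nu>\<^sub>n)\<close>.  The infimum defining \<open>\<tau>\<^sub>n\<close> is unspecified when no point is
  accepted.\<close>

primrec skeleton ::
  "enat \<Rightarrow> (nat \<Rightarrow> 'k) \<Rightarrow> real \<Rightarrow> 'k chars \<Rightarrow> 'k \<times> real \<Rightarrow> sample \<Rightarrow> nat \<Rightarrow> nat \<times> 'k \<times> real" where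
  "skeleton K k lstar c x s 0 = (0, x)"
| "skeleton K k lstar c x s (Suc n) =
     (let (\<tau>, \<theta>, \<nu>) = skeleton K k lstar c x s n;
          \<tau>' = Inf {j. \<tau> < j \<and>
                 unifU s j * lstar \<le> intensity c (\<theta>, flow c \<theta> (Tstar s j - Tstar s \<tau>) \<nu>)};
          \<nu>' = flow c \<theta> (Tstar s \<tau>' - Tstar s \<tau>) \<nu>;
          \<theta>' = select K k (kernel c) (\<theta>, \<nu>') (unifV s (Suc n))
      in (\<tau>', \<theta>', \<nu>'))"

definition jump_index ::
  "enat \<Rightarrow> (nat \<Rightarrow> 'k) \<Rightarrow> real \<Rightarrow> 'k chars \<Rightarrow> 'k \<times> real \<Rightarrow> sample \<Rightarrow> nat \<Rightarrow> nat" where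
  "jump_index K k lstar c x s n = fst (skeleton K k lstar c x s n)"

definition mode ::
  "enat \<Rightarrow> (nat \<Rightarrow> 'k) \<Rightarrow> real \<Rightarrow> 'k chars \<Rightarrow> 'k \<times> real \<Rightarrow> sample \<Rightarrow> nat \<Rightarrow> 'k" where
  "mode K k lstar c x s n = fst (snd (skeleton K k lstar c x s n))"

definition position ::
  "enat \<Rightarrow> (nat \<Rightarrow> 'k) \<Rightarrow> real \<Rightarrow> 'k chars \<Rightarrow> 'k \<times> real \<Rightarrow> sample \<Rightarrow> nat \<Rightarrow> real" where
  "position K k lstar c x s n = snd (snd (skeleton K k lstar c x s n))"

definition pdp_time ::
  "enat \<Rightarrow> (nat \<Rightarrow> 'k) \<Rightarrow> real \<Rightarrow> 'k chars \<Rightarrow> 'k \<times> real \<Rightarrow> sample \<Rightarrow> nat \<Rightarrow> real" where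
  "pdp_time K k lstar c x s n = Tstar s (jump_index K k lstar c x s n)"

definition pdp ::
  "enat \<Rightarrow> (nat \<Rightarrow> 'k) \<Rightarrow> real \<Rightarrow> 'k chars \<Rightarrow> 'k \<times> real \<Rightarrow> sample \<Rightarrow> real \<Rightarrow> 'k \<times> real" where
  "pdp K k lstar c x s t =
     (if t = 0 then x
      else let n = (THE n. pdp_time K k lstar c x s n \<le> t \<and> t < pdp_time K k lstar c x s (Suc n));
               \<theta> = mode K k lstar c x s n
           in (\<theta>, flow c \<theta> (t - pdp_time K k lstar c x s n) (position K k lstar c x s n)))"

definition jump_count ::
  "enat \<Rightarrow> (nat \<Rightarrow> 'k) \<Rightarrow> real \<Rightarrow> 'k chars \<Rightarrow> 'k \<times> real \<Rightarrow> sample \<Rightarrow> real \<Rightarrow> nat" where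
  "jump_count K k lstar c x s t = card {n. 1 \<le> n \<and> pdp_time K k lstar c x s n \<le> t}"

text \<open>Below \<open>c\<close> carries the characteristics \<open>(\<Phi>, \<lambda>~, Q~)\<close> of the simulated process, whereas
  \<open>lam\<close> and \<open>Q\<close> are the target intensity and transition measure.  As \<open>\<lambda>~\<close> and \<open>Q~\<close> do not
  depend on \<open>\<nu>\<close> in the application, they may be evaluated at the current \<open>\<nu>\<close>-component.\<close>

definition kappa ::
  "enat \<Rightarrow> (nat \<Rightarrow> 'k) \<Rightarrow> real \<Rightarrow> 'k chars \<Rightarrow> 'k \<times> real \<Rightarrow> sample
    \<Rightarrow> ('k \<times> real \<Rightarrow> ('k \<times> real) measure) \<Rightarrow> nat \<Rightarrow> real" where
  "kappa K k lstar c x s Q l =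
     (if l = 0 then 1
      else let y = (mode K k lstar c x s (l - 1), position K k lstar c x s l);
               \<theta> = mode K k lstar c x s l
           in mode_prob Q y {\<theta>} / mode_prob (kernel c) y {\<theta>})"

text \<open>\<open>acc \<dots> l q\<close> is \<open>\<lambda>(\<theta>~\<^sub>l, \<Phi>(T\<^sup>*\<^sub>q - T\<^sup>*\<^sub>\<tau>, \<nu>~\<^sub>l)) / \<lambda>\<^sup>*\<close> with \<open>\<tau> = \<tau>~\<^sub>l\<close>, and
  \<open>acc_sim \<dots> l\<close> is \<open>\<lambda>~(\<theta>~\<^sub>l) / \<lambda>\<^sup>*\<close>.\<close>

definition acc ::
  "enat \<Rightarrow> (nat \<Rightarrow> 'k) \<Rightarrow> real \<Rightarrow> 'k chars \<Rightarrow> 'k \<times> real \<Rightarrow> sample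
    \<Rightarrow> ('k \<times> real \<Rightarrow> real) \<Rightarrow> nat \<Rightarrow> nat \<Rightarrow> real" where
  "acc K k lstar c x s lam l q =
     (let \<theta> = mode K k lstar c x s l
      in lam (\<theta>, flow c \<theta> (Tstar s q - Tstar s (jump_index K k lstar c x s l))
                         (position K k lstar c x s l)) / lstar)"

definition acc_sim ::
  "enat \<Rightarrow> (nat \<Rightarrow> 'k) \<Rightarrow> real \<Rightarrow> 'k chars \<Rightarrow> 'k \<times> real \<Rightarrow> sample \<Rightarrow> nat \<Rightarrow> real" where
  "acc_sim K k lstar c x s l =
     intensity c (mode K k lstar c x s l, position K k lstar c x s l) / lstar"

definition Z_inner ::
  "enat \<Rightarrow> (nat \<Rightarrow> 'k) \<Rightarrow> real \<Rightarrow> 'k chars \<Rightarrow> 'k \<times> real \<Rightarrow> sample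
    \<Rightarrow> ('k \<times> real \<Rightarrow> real) \<Rightarrow> ('k \<times> real \<Rightarrow> ('k \<times> real) measure) \<Rightarrow> nat \<Rightarrow> real" where
  "Z_inner K k lstar c x s lam Q l =
     (let \<tau> = jump_index K k lstar c x s l; \<tau>' = jump_index K k lstar c x s (Suc l);
          p = acc_sim K k lstar c x s l
      in kappa K k lstar c x s Q l * inverse (p * (1 - p) ^ (\<tau>' - \<tau> - 1))
         * acc K k lstar c x s lam l \<tau>'
         * (\<Prod>q\<in>{\<tau><..<\<tau>'}. 1 - acc K k lstar c x s lam l q))"

definition Z_last ::
  "enat \<Rightarrow> (nat \<Rightarrow> 'k) \<Rightarrow> real \<Rightarrow> 'k chars \<Rightarrow> 'k \<times> real \<Rightarrow> sample
    \<Rightarrow> ('k \<times> real \<Rightarrow> real) \<Rightarrow> ('k \<times> real \<Rightarrow> ('k \<times> real) measure) \<Rightarrow> real \<Rightarrow> nat \<Rightarrow> real" where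
  "Z_last K k lstar c x s lam Q t n =
     (let \<tau> = jump_index K k lstar c x s n; p = acc_sim K k lstar c x s n
      in kappa K k lstar c x s Q n * inverse ((1 - p) ^ (pois s t - \<tau>))
         * (\<Prod>q\<in>{\<tau><..pois s t}. 1 - acc K k lstar c x s lam n q))"

definition weight ::
  "enat \<Rightarrow> (nat \<Rightarrow> 'k) \<Rightarrow> real \<Rightarrow> 'k chars \<Rightarrow> 'k \<times> real \<Rightarrow> sample
    \<Rightarrow> ('k \<times> real \<Rightarrow> real) \<Rightarrow> ('k \<times> real \<Rightarrow> ('k \<times> real) measure) \<Rightarrow> real \<Rightarrow> real" where
  "weight K k lstar c x s lam Q t =
     (let n = jump_count K k lstar c x s t
      in Z_last K k lstar c x s lam Q t n * (\<Prod>l<n. Z_inner K k lstar c x s lam Q l))"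

end

theory Submission
  imports Defs
begin

text \<open>
  Since the simulated intensity and kernel do not depend on \<open>\<nu>\<close>, the two processes built from the
  same data share all jump indices and modes, even where \<open>THE\<close> or \<open>Inf\<close> return junk. Their positions
  differ by \<open>O(h)\<close>, and the two weights are a common factor times products of numbers in \<open>[0, 1]\<close>
  that depend on the positions in a Lipschitz way. This gives a pathwise bound \<open>const * h * r ^ N\<^sub>T\<close>
  on almost every path, and \<open>N\<^sub>T\<close>, being Poisson distributed, has exponential moments of all orders.
\<close>

section \<open>Jump times of a right-continuous counting path\<close>

text \<open>A right-continuous path with discrete values is constant just to the right of every
  point, so the infimum defining the jump time is attained; monotonicity then gives the equivalence.
  The assumption \<open>ex\<close> keeps the infimum away from the empty set.\<close>

lemma le_jump_value_iff:
  assumes mono: "mono_on {0..} f" and cont: "\<And>t. 0 \<le> t \<Longrightarrow> continuous (at_right t) f"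
    and ex: "\<exists>t\<ge>0. j \<le> f t" and t: "0 \<le> t"
  shows "jump_time f j \<le> t \<longleftrightarrow> j \<le> f t"
proof -
  define S where "S = {t. 0 \<le> t \<and> j \<le> f t}"
  have ne: "S \<noteq> {}" and bdd: "bdd_below S"
    using ex by (auto simp: S_def intro: bdd_belowI[of _ 0])
  have I0: "0 \<le> Inf S"
    using ne by (intro cInf_greatest) (auto simp: S_def)
  have "\<forall>\<^sub>F s in at_right (Inf S). f s = f (Inf S)"
    using cont[OF I0] by (simp add: continuous_within tendsto_discrete)
  then obtain b where b: "Inf S < b" "\<And>s. Inf S < s \<Longrightarrow> s < b \<Longrightarrow> f s = f (Inf S)"
    by (auto simp: eventually_at_right_field)
  obtain s where s: "s \<in> S" "s < b"
    using b(1) ne bdd by (meson cInf_less_iff)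
  have "Inf S \<le> s"
    using s(1) bdd by (rule cInf_lower)
  then have I: "j \<le> f (Inf S)"
    using b(2)[of s] s by (cases "s = Inf S") (auto simp: S_def)
  show ?thesis
  proof
    assume "jump_time f j \<le> t"
    then have "Inf S \<le> t" by (simp add: jump_time_def S_def)
    then have "f (Inf S) \<le> f t" using mono I0 t by (auto simp: mono_on_def)
    then show "j \<le> f t" using I by simp
  next
    assume "j \<le> f t"
    then show "jump_time f j \<le> t"
      using t bdd by (auto simp: jump_time_def S_def intro!: cInf_lower)
  qed
qed

lemma jump_time_nonneg:
  assumes "\<exists>t\<ge>0. j \<le> f t"
  shows "0 \<le> jump_time f j"
  using assms unfolding jump_time_def by (intro cInf_greatest) auto

lemma jump_time_mono:
  assumes "i \<le> j" "\<exists>t\<ge>0. j \<le> f t"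
  shows "jump_time f i \<le> jump_time f j"
  unfolding jump_time_def
  using assms by (intro cInf_superset_mono) (auto intro: bdd_belowI[of _ 0])

section \<open>Differences of products of numbers of modulus at most one\<close>

lemma abs_mult_diff_le:
  fixes x y :: real
  assumes "\<bar>x\<bar> \<le> 1" "\<bar>y'\<bar> \<le> 1"
  shows "\<bar>x * y - x' * y'\<bar> \<le> \<bar>x - x'\<bar> + \<bar>y - y'\<bar>"
proof -
  have "x * y - x' * y' = x * (y - y') + (x - x') * y'" by (simp add: algebra_simps)
  also have "\<bar>\<dots>\<bar> \<le> \<bar>x\<bar> * \<bar>y - y'\<bar> + \<bar>x - x'\<bar> * \<bar>y'\<bar>"
    by (metis abs_mult abs_triangle_ineq)
  also have "\<dots> \<le> 1 * \<bar>y - y'\<bar> + \<bar>x - x'\<bar> * 1"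
    using assms by (intro add_mono mult_right_mono mult_left_mono) auto
  finally show ?thesis by simp
qed

text \<open>Telescoping makes the error additive in the factors. The separate bound \<open>m\<close>
  on the cardinality lets the number of Poisson points up to \<open>T\<close> stand in for the size
  of every index set.\<close>

lemma abs_prod_diff_le:
  fixes f g :: "'a \<Rightarrow> real"
  assumes "\<And>i. i \<in> I \<Longrightarrow> \<bar>f i\<bar> \<le> 1" "\<And>i. i \<in> I \<Longrightarrow> \<bar>g i\<bar> \<le> 1"
    and "\<And>i. i \<in> I \<Longrightarrow> \<bar>f i - g i\<bar> \<le> d" and "card I \<le> m" "0 \<le> d"
  shows "\<bar>prod f I - prod g I\<bar> \<le> real m * d"
proof -
  have "\<bar>prod f I - prod g I\<bar> \<le> (\<Sum>i\<in>I. \<bar>f i - g i\<bar>)"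
    using norm_prod_diff[of I f g] assms(1,2) by simp
  also have "\<dots> \<le> real (card I) * d"
    using assms(3) by (intro sum_bounded_above) auto
  also have "\<dots> \<le> real m * d"
    using assms(4,5) by (intro mult_right_mono) auto
  finally show ?thesis .
qed

section \<open>The two processes along one fixed path of the data\<close>

text \<open>All estimates are deterministic once a good path is fixed. \<open>pois_unbounded\<close>
  and \<open>unifU_small\<close> are the properties that hold only almost surely. The parameter
  \<open>a\<close> stands for \<open>exp (C1 * T)\<close> and \<open>e\<close> for
  \<open>C2 * h\<close>; \<open>lt0\<close> and \<open>Qt0\<close> are the simulated intensity and
  kernel as functions of the mode alone.\<close>

locale coupled_paths =
  fixes K :: enat and k :: "nat \<Rightarrow> 'k" and s :: sample
    and lstar T a e L_lam L_Q \<rho> lt_min lt_max :: real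
    and x :: "'k \<times> real"
    and \<Phi> \<Psi> :: "'k \<Rightarrow> real \<Rightarrow> real \<Rightarrow> real"
    and lam lt :: "'k \<times> real \<Rightarrow> real"
    and Q Qt :: "'k \<times> real \<Rightarrow> ('k \<times> real) measure"
    and lt0 :: "'k \<Rightarrow> real" and Qt0 :: "'k \<Rightarrow> 'k set \<Rightarrow> real"
  assumes pois_mono: "mono_on {0..} (pois s)"
    and pois_right_cont: "\<And>t. 0 \<le> t \<Longrightarrow> continuous (at_right t) (pois s)"
    and pois_unbounded: "\<And>j. \<exists>t\<ge>0. j \<le> pois s t"
    and unifU_small: "\<And>m. \<exists>j>m. unifU s j * lstar \<le> lt_min"
    and T: "0 < T"
    and a: "1 \<le> a" and e: "0 \<le> e"
    and scheme: "\<And>\<theta> t \<nu>1 \<nu>2. t \<in> {0..T} \<Longrightarrow> \<bar>\<Phi> \<theta> t \<nu>1 - \<Psi> \<theta> t \<nu>2\<bar> \<le> a * \<bar>\<nu>1 - \<nu>2\<bar> + e"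
    and lam: "\<And>y. 0 < lam y" "\<And>y. lam y \<le> lstar"
    and mode_prob_le: "\<And>y A. mode_prob Q y A \<le> 1"
    and lam_lipschitz: "0 < L_lam" "\<And>\<theta>. L_lam-lipschitz_on UNIV (\<lambda>\<nu>. lam (\<theta>, \<nu>))"
    and Q_lipschitz: "0 < L_Q" "\<And>\<theta> A. L_Q-lipschitz_on UNIV (\<lambda>\<nu>. mode_prob Q (\<theta>, \<nu>) A)"
    and lt: "\<And>\<theta> \<nu>. lt (\<theta>, \<nu>) = lt0 \<theta>"
    and Qt: "\<And>\<theta> \<nu> A. mode_prob Qt (\<theta>, \<nu>) A = Qt0 \<theta> A"
    and Qt_bound: "0 < \<rho>" "\<And>i j. \<rho> \<le> Qt0 i {j}" "\<And>i j. Qt0 i {j} \<le> 1"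
    and lt_bound: "0 < lt_min" "lt_max < lstar" "\<And>i. lt_min \<le> lt0 i" "\<And>i. lt0 i \<le> lt_max"
begin

abbreviation c :: "'k chars" where "c \<equiv> \<lparr>flow = \<Phi>, intensity = lt, kernel = Qt\<rparr>"
abbreviation c' :: "'k chars" where "c' \<equiv> \<lparr>flow = \<Psi>, intensity = lt, kernel = Qt\<rparr>"

abbreviation "\<tau> \<equiv> jump_index K k lstar c x s"
abbreviation "\<theta> \<equiv> mode K k lstar c x s"
abbreviation "\<nu> \<equiv> position K k lstar c x s"
abbreviation "\<nu>' \<equiv> position K k lstar c' x s"
abbreviation "m \<equiv> pois s T"

lemma lstar_pos: "0 < lstar"
  \<comment> \<open>\<open>undefined\<close> serves as an arbitrary mode; any mode shows
    \<open>lt_min \<le> lt_max\<close>.\<close>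
  using lt_bound(1,2) lt_bound(3)[of undefined] lt_bound(4)[of undefined] by linarith

lemma select_kernel:
  "select K k Qt (i, v) u = select K k Qt (i, v') u"
  by (simp add: select_def cumul_def Qt)

text \<open>Positions enter the recursion for index and mode only through \<open>lt\<close> and
  \<open>Qt\<close>, which ignore them. Both claims go through one induction because the acceptance
  test for the next index depends on the current mode.\<close>

lemma skeleton_coupled:
  "jump_index K k lstar c' x s n = \<tau> n \<and> mode K k lstar c' x s n = \<theta> n"
proof (induction n)
  case (Suc n)
  obtain t i v where 1: "skeleton K k lstar c x s n = (t, i, v)" by (metis prod_cases3)
  obtain t' i' v' where 2: "skeleton K k lstar c' x s n = (t', i', v')" by (metis prod_cases3)
  show ?case
    using Suc 1 2 by (auto simp: jump_index_def mode_def Let_def lt intro: select_kernel)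
qed (simp add: jump_index_def mode_def)

lemmas jump_index_coupled = skeleton_coupled[THEN conjunct1]
  and mode_coupled = skeleton_coupled[THEN conjunct2]

text \<open>By \<open>unifU_small\<close> some later point is accepted whatever the mode, so the
  infimum is taken over a nonempty set of naturals and belongs to it.\<close>

lemma jump_index_Suc: "\<tau> n < \<tau> (Suc n)"
proof -
  obtain t i v where 1: "skeleton K k lstar c x s n = (t, i, v)" by (metis prod_cases3)
  let ?S = "{j. t < j \<and> unifU s j * lstar \<le> lt0 i}"
  have "?S \<noteq> {}"
    using unifU_small[of t] lt_bound(3)[of i] by force
  then have "Inf ?S \<in> ?S" by (rule Inf_nat_def1)
  then show ?thesis
    using 1 by (simp add: jump_index_def Let_def lt)
qed

lemma strict_mono_jump_index: "strict_mono \<tau>"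
  using jump_index_Suc by (simp add: strict_mono_Suc_iff)

lemma jump_index_0: "\<tau> 0 = 0"
  by (simp add: jump_index_def)

lemma position_0: "\<nu>' 0 = \<nu> 0"
  by (simp add: position_def)

lemma position_Suc:
  "\<nu> (Suc n) = \<Phi> (\<theta> n) (Tstar s (\<tau> (Suc n)) - Tstar s (\<tau> n)) (\<nu> n)"
  by (simp add: position_def mode_def jump_index_def Let_def split: prod.split)

lemma position'_Suc:
  "\<nu>' (Suc n) = \<Psi> (\<theta> n) (Tstar s (\<tau> (Suc n)) - Tstar s (\<tau> n)) (\<nu>' n)"
proof -
  have "\<nu>' (Suc n) = \<Psi> (mode K k lstar c' x s n)
     (Tstar s (jump_index K k lstar c' x s (Suc n)) - Tstar s (jump_index K k lstar c' x s n)) (\<nu>' n)"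
    by (simp add: position_def mode_def jump_index_def Let_def split: prod.split)
  then show ?thesis by (simp only: jump_index_coupled mode_coupled)
qed

section \<open>Distance between the positions of the two processes\<close>

lemma Tstar_le_iff: "0 \<le> t \<Longrightarrow> Tstar s j \<le> t \<longleftrightarrow> j \<le> pois s t"
  by (rule le_jump_value_iff[OF pois_mono pois_right_cont pois_unbounded])

text \<open>Places the elapsed times in the interval on which the scheme estimate is
  available.\<close>

lemma Tstar_diff:
  assumes "i \<le> j" "j \<le> m"
  shows "Tstar s j - Tstar s i \<in> {0..T}"
  using jump_time_mono[OF assms(1) pois_unbounded] jump_time_nonneg[OF pois_unbounded, of i]
    Tstar_le_iff[of T j] T assms(2) by auto

text \<open>Discrete Gronwall argument: the error starts at 0 and each jump maps it to at most
  \<open>a\<close> times itself plus \<open>e\<close>.\<close>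

lemma position_diff:
  assumes "\<tau> n \<le> m"
  shows "\<bar>\<nu> n - \<nu>' n\<bar> \<le> e * (real n * a ^ n)"
  using assms
proof (induction n)
  case (Suc n)
  have le: "\<tau> n \<le> \<tau> (Suc n)" using jump_index_Suc[of n] by simp
  have "\<bar>\<nu> (Suc n) - \<nu>' (Suc n)\<bar> \<le> a * \<bar>\<nu> n - \<nu>' n\<bar> + e"
    unfolding position_Suc position'_Suc
    by (rule scheme[OF Tstar_diff[OF le Suc.prems]])
  \<comment> \<open>Since \<open>a \<ge> 1\<close>, the new error \<open>e\<close> may be inflated
    to \<open>e * a ^ Suc n\<close>, which merges with the first term.\<close>
  also have "\<dots> \<le> a * (e * (real n * a ^ n)) + e * a ^ Suc n"
    using Suc le a e one_le_power[OF a, of "Suc n"]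
    by (intro add_mono mult_left_mono) (auto simp: mult_le_cancel_left1)
  also have "\<dots> = e * (real (Suc n) * a ^ Suc n)" by (simp add: algebra_simps)
  finally show ?case .
qed (simp add: position_0)

text \<open>A single bound for all positions and flows up to \<open>T\<close>. There are at most
  \<open>m\<close> jumps, and \<open>m + 1\<close> leaves room for one further flow step after the
  last of them.\<close>

definition dev :: real where "dev = e * (real (m + 1) * a ^ (m + 1))"

lemma dev_nonneg: "0 \<le> dev"
  using a e by (simp add: dev_def)

text \<open>A strictly increasing sequence of naturals dominates its index, so there are no more
  jumps than Poisson points.\<close>

lemma index_le: "\<tau> n \<le> m \<Longrightarrow> n \<le> m"
  using strict_mono_imp_increasing[OF strict_mono_jump_index, of n] by simp

lemma dev_ge: "n \<le> m + 1 \<Longrightarrow> e * (real n * a ^ n) \<le> dev"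
  unfolding dev_def using a e by (intro mult_left_mono mult_mono power_increasing) auto

lemma position_dev:
  assumes "\<tau> n \<le> m"
  shows "\<bar>\<nu> n - \<nu>' n\<bar> \<le> dev"
  using position_diff[OF assms] dev_ge[of n] index_le[OF assms] by simp

lemma flow_dev:
  assumes "\<tau> n \<le> m" "t \<in> {0..T}"
  shows "\<bar>\<Phi> i t (\<nu> n) - \<Psi> i t (\<nu>' n)\<bar> \<le> dev"
proof -
  have "\<bar>\<Phi> i t (\<nu> n) - \<Psi> i t (\<nu>' n)\<bar> \<le> a * \<bar>\<nu> n - \<nu>' n\<bar> + e"
    using assms(2) by (rule scheme)
  also have "\<dots> \<le> a * (e * (real n * a ^ n)) + e * a ^ Suc n"
    using position_diff[OF assms(1)] a e one_le_power[OF a, of "Suc n"]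
    by (intro add_mono mult_left_mono) (auto simp: mult_le_cancel_left1)
  also have "\<dots> = e * (real (Suc n) * a ^ Suc n)" by (simp add: algebra_simps)
  also have "\<dots> \<le> dev" using index_le[OF assms(1)] by (intro dev_ge) simp
  finally show ?thesis .
qed

section \<open>Lipschitz estimate for the acceptance probabilities\<close>

text \<open>The sum of the Lipschitz constants of the target kernel and of the acceptance
  probability \<open>lam / lstar\<close>, so that one constant serves both kinds of factor.\<close>

definition L :: real where "L = L_Q + L_lam / lstar"

lemma L_pos: "0 < L"
  using Q_lipschitz(1) lam_lipschitz(1) lstar_pos by (simp add: L_def add_pos_pos)

abbreviation "acc\<Phi> \<equiv> acc K k lstar c x s lam"
abbreviation "acc\<Psi> \<equiv> acc K k lstar c' x s lam"

lemma acc_bounds: "0 \<le> acc K k lstar d x s lam l q" "acc K k lstar d x s lam l q \<le> 1"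
  using lam lstar_pos by (auto simp: acc_def Let_def less_imp_le)

lemma acc_diff:
  assumes "\<tau> l \<le> q" "q \<le> m"
  shows "\<bar>acc\<Phi> l q - acc\<Psi> l q\<bar> \<le> L * dev"
proof -
  let ?t = "Tstar s q - Tstar s (\<tau> l)"
  let ?u = "\<Phi> (\<theta> l) ?t (\<nu> l)" and ?v = "\<Psi> (\<theta> l) ?t (\<nu>' l)"
  have "acc\<Phi> l q - acc\<Psi> l q = (lam (\<theta> l, ?u) - lam (\<theta> l, ?v)) / lstar"
    by (simp add: acc_def Let_def jump_index_coupled mode_coupled diff_divide_distrib)
  then have "\<bar>acc\<Phi> l q - acc\<Psi> l q\<bar> = \<bar>lam (\<theta> l, ?u) - lam (\<theta> l, ?v)\<bar> / lstar"
    using lstar_pos by simp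
  also have "\<dots> \<le> L_lam * \<bar>?u - ?v\<bar> / lstar"
    using lipschitz_onD[OF lam_lipschitz(2), of ?u ?v "\<theta> l"] lstar_pos
    by (intro divide_right_mono) (auto simp: dist_real_def)
  also have "\<dots> \<le> L_lam * dev / lstar"
    using flow_dev[of l ?t "\<theta> l"] Tstar_diff[OF assms] assms lam_lipschitz(1) lstar_pos
    by (intro divide_right_mono mult_left_mono) auto
  also have "\<dots> \<le> L * dev"
    using Q_lipschitz(1) dev_nonneg by (simp add: L_def algebra_simps)
  finally show ?thesis .
qed

section \<open>Factorisation of the weights and comparison of the position-dependent factors\<close>

text \<open>The numerator of \<open>kappa\<close>. The positions are an argument \<open>v\<close>,
  whereas the modes are the shared ones, so the same function describes both processes.\<close>

definition target_kernel :: "(nat \<Rightarrow> real) \<Rightarrow> nat \<Rightarrow> real" where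
  "target_kernel v l = (if l = 0 then 1 else mode_prob Q (\<theta> (l - 1), v l) {\<theta> l})"

definition sim_kernel :: "nat \<Rightarrow> real" where
  "sim_kernel l = (if l = 0 then 1 else Qt0 (\<theta> (l - 1)) {\<theta> l})"

lemma target_kernel_bounds: "0 \<le> target_kernel v l" "target_kernel v l \<le> 1"
  using mode_prob_le by (auto simp: target_kernel_def mode_prob_def)

lemma target_kernel_diff:
  assumes "\<tau> l \<le> m"
  shows "\<bar>target_kernel \<nu> l - target_kernel \<nu>' l\<bar> \<le> L * dev"
proof (cases "l = 0")
  case True
  then show ?thesis using L_pos dev_nonneg by (simp add: target_kernel_def)
next
  case False
  then have "\<bar>target_kernel \<nu> l - target_kernel \<nu>' l\<bar> \<le> L_Q * \<bar>\<nu> l - \<nu>' l\<bar>"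
    using lipschitz_onD[OF Q_lipschitz(2), of "\<nu> l" "\<nu>' l" "\<theta> (l - 1)" "{\<theta> l}"]
    by (simp add: target_kernel_def dist_real_def)
  also have "\<dots> \<le> L_Q * dev"
    using position_dev[OF assms] Q_lipschitz(1) by (intro mult_left_mono) auto
  also have "\<dots> \<le> L * dev"
    using lam_lipschitz(1) lstar_pos dev_nonneg by (intro mult_right_mono) (auto simp: L_def)
  finally show ?thesis .
qed

lemma sim_kernel_ge: "\<rho> \<le> sim_kernel l"
  \<comment> \<open>At \<open>l = 0\<close> the value is 1 by convention, and
    \<open>\<rho> \<le> 1\<close> follows from any single kernel entry.\<close>
  using Qt_bound(2) order_trans[OF Qt_bound(2) Qt_bound(3)] by (auto simp: sim_kernel_def)

lemma kappa_eq:
  "kappa K k lstar c x s Q l = target_kernel \<nu> l / sim_kernel l"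
  "kappa K k lstar c' x s Q l = target_kernel \<nu>' l / sim_kernel l"
  by (auto simp: kappa_def target_kernel_def sim_kernel_def Let_def Qt mode_coupled)

text \<open>Each weight is a factor common to both processes times a product of numbers in
  \<open>[0, 1]\<close>, which makes the difference of the weights additive over the factors.\<close>

definition inner :: "(nat \<Rightarrow> real) \<Rightarrow> (nat \<Rightarrow> nat \<Rightarrow> real) \<Rightarrow> nat \<Rightarrow> real" where
  "inner v p l = target_kernel v l * (p l (\<tau> (Suc l)) * (\<Prod>q\<in>{\<tau> l<..<\<tau> (Suc l)}. 1 - p l q))"

definition final :: "(nat \<Rightarrow> real) \<Rightarrow> (nat \<Rightarrow> nat \<Rightarrow> real) \<Rightarrow> nat \<Rightarrow> real" where
  "final v p l = target_kernel v l * (\<Prod>q\<in>{\<tau> l<..m}. 1 - p l q)"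

abbreviation "p0 l \<equiv> lt0 (\<theta> l) / lstar"

text \<open>The reciprocal of the simulated probability of entering the current mode, rejecting the
  points before the next jump and accepting the one at that jump; no position occurs in it.\<close>

definition common_inner :: "nat \<Rightarrow> real" where
  "common_inner l = inverse (sim_kernel l * (p0 l * (1 - p0 l) ^ (\<tau> (Suc l) - \<tau> l - 1)))"

definition common_final :: "nat \<Rightarrow> real" where
  "common_final l = inverse (sim_kernel l * (1 - p0 l) ^ (m - \<tau> l))"

lemma Z_inner_eq:
  "Z_inner K k lstar c x s lam Q l = common_inner l * inner \<nu> acc\<Phi> l"
  "Z_inner K k lstar c' x s lam Q l = common_inner l * inner \<nu>' acc\<Psi> l"
  by (simp_all add: Z_inner_def Let_def acc_sim_def lt kappa_eq inner_def common_inner_def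
      jump_index_coupled mode_coupled divide_inverse inverse_mult_distrib)

lemma Z_last_eq:
  "Z_last K k lstar c x s lam Q T l = common_final l * final \<nu> acc\<Phi> l"
  "Z_last K k lstar c' x s lam Q T l = common_final l * final \<nu>' acc\<Psi> l"
  by (simp_all add: Z_last_def Let_def acc_sim_def lt kappa_eq final_def common_final_def
      jump_index_coupled mode_coupled divide_inverse inverse_mult_distrib)

lemma prod_one_minus_acc:
  "\<bar>\<Prod>q\<in>I. 1 - acc K k lstar d x s lam l q\<bar> \<le> 1"
  using acc_bounds by (auto simp: abs_prod intro!: prod_le_1)

lemma inner_abs_le:
  "\<bar>inner v (acc K k lstar d x s lam) l\<bar> \<le> 1"
  unfolding inner_def abs_mult
  using target_kernel_bounds[of v l] acc_bounds prod_one_minus_acc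
  by (intro mult_le_one) auto

lemma final_abs_le:
  "\<bar>final v (acc K k lstar d x s lam) l\<bar> \<le> 1"
  unfolding final_def abs_mult
  using target_kernel_bounds[of v l] acc_bounds prod_one_minus_acc
  by (intro mult_le_one) auto

text \<open>One kernel factor, one acceptance factor and at most \<open>m\<close> rejection factors
  each contribute \<open>L * dev\<close>.\<close>

lemma inner_diff:
  assumes "\<tau> (Suc l) \<le> m"
  shows "\<bar>inner \<nu> acc\<Phi> l - inner \<nu>' acc\<Psi> l\<bar> \<le> (real m + 2) * (L * dev)"
proof -
  have le: "\<tau> l \<le> \<tau> (Suc l)" using jump_index_Suc[of l] by simp
  have 1: "\<bar>target_kernel \<nu> l - target_kernel \<nu>' l\<bar> \<le> L * dev"
    using assms le by (intro target_kernel_diff) simp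
  have 2: "\<bar>acc\<Phi> l (\<tau> (Suc l)) - acc\<Psi> l (\<tau> (Suc l))\<bar> \<le> L * dev"
    using assms le by (intro acc_diff)
  have 3: "\<bar>(\<Prod>q\<in>{\<tau> l<..<\<tau> (Suc l)}. 1 - acc\<Phi> l q) - (\<Prod>q\<in>{\<tau> l<..<\<tau> (Suc l)}. 1 - acc\<Psi> l q)\<bar>
      \<le> real m * (L * dev)"
    using assms acc_diff[of l] acc_bounds L_pos dev_nonneg
    by (intro abs_prod_diff_le) (auto simp: abs_minus_commute)
  have "\<bar>inner \<nu> acc\<Phi> l - inner \<nu>' acc\<Psi> l\<bar> \<le> L * dev + (L * dev + real m * (L * dev))"
    unfolding inner_def
    using target_kernel_bounds acc_bounds prod_one_minus_acc
    by (intro order_trans[OF abs_mult_diff_le] add_mono 1 2 3)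
      (auto simp: abs_mult intro!: mult_le_one)
  then show ?thesis by (simp add: algebra_simps)
qed

lemma final_diff:
  assumes "\<tau> l \<le> m"
  shows "\<bar>final \<nu> acc\<Phi> l - final \<nu>' acc\<Psi> l\<bar> \<le> (real m + 2) * (L * dev)"
proof -
  have 1: "\<bar>target_kernel \<nu> l - target_kernel \<nu>' l\<bar> \<le> L * dev"
    using assms by (intro target_kernel_diff) simp
  have 2: "\<bar>(\<Prod>q\<in>{\<tau> l<..m}. 1 - acc\<Phi> l q) - (\<Prod>q\<in>{\<tau> l<..m}. 1 - acc\<Psi> l q)\<bar>
      \<le> real m * (L * dev)"
    using assms acc_diff[of l] acc_bounds L_pos dev_nonneg
    by (intro abs_prod_diff_le) (auto simp: abs_minus_commute)
  have "\<bar>final \<nu> acc\<Phi> l - final \<nu>' acc\<Psi> l\<bar> \<le> L * dev + real m * (L * dev)"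
    unfolding final_def
    using target_kernel_bounds prod_one_minus_acc
    by (intro order_trans[OF abs_mult_diff_le] add_mono 1 2) auto
  \<comment> \<open>There is no acceptance factor here; the bound is relaxed to the one of
    \<open>inner_diff\<close> so that all segments are treated alike.\<close>
  also have "\<dots> \<le> (real m + 2) * (L * dev)"
    using L_pos dev_nonneg by (simp add: distrib_right)
  finally show ?thesis .
qed

section \<open>Exponential bound for the common factor\<close>

text \<open>\<open>A\<close> bounds the reciprocal of kernel entry times acceptance probability,
  paid once per jump. \<open>B\<close> bounds the reciprocal of a rejection probability and is
  finite because \<open>lt_max < lstar\<close>.\<close>

definition A :: real where "A = lstar / (\<rho> * lt_min)"
definition B :: real where "B = lstar / (lstar - lt_max)"

lemma A_ge_1: "1 \<le> A" and B_ge_1: "1 \<le> B"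
proof -
  have "\<rho> * lt_min \<le> 1 * lstar"
    using Qt_bound(1) Qt_bound(2)[of undefined undefined] Qt_bound(3)[of undefined undefined]
      lt_bound(1,2) lt_bound(3)[of undefined] lt_bound(4)[of undefined]
    by (intro mult_mono) linarith+
  then show "1 \<le> A" using Qt_bound(1) lt_bound(1) by (simp add: A_def)
  have "0 < lt_max" using lt_bound(1) lt_bound(3)[of undefined] lt_bound(4)[of undefined] by linarith
  then show "1 \<le> B" using lt_bound(2) by (simp add: B_def)
qed

lemma p0_bounds: "lt_min / lstar \<le> p0 l" "inverse B \<le> 1 - p0 l" "0 < p0 l"
proof -
  show "lt_min / lstar \<le> p0 l"
    using lt_bound lstar_pos by (auto intro: divide_right_mono)
  have "inverse B = 1 - lt_max / lstar" using lstar_pos by (simp add: B_def diff_divide_distrib)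
  also have "\<dots> \<le> 1 - p0 l"
    using lt_bound lstar_pos by (auto intro: divide_right_mono)
  finally show "inverse B \<le> 1 - p0 l" .
  show "0 < p0 l" using lt_bound(1) lt_bound(3)[of "\<theta> l"] lstar_pos by simp
qed

lemma inverse_one_minus_p0: "0 < 1 - p0 l" "inverse ((1 - p0 l) ^ j) \<le> B ^ j"
proof -
  have B: "0 < inverse B" using B_ge_1 by simp
  then show "0 < 1 - p0 l" using p0_bounds(2)[of l] by linarith
  have "(inverse B) ^ j \<le> (1 - p0 l) ^ j"
    using p0_bounds(2) B by (intro power_mono) auto
  then have "inverse ((1 - p0 l) ^ j) \<le> inverse ((inverse B) ^ j)"
    using B by (intro le_imp_inverse_le) auto
  then show "inverse ((1 - p0 l) ^ j) \<le> B ^ j" by (simp add: power_inverse)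
qed

lemma sim_kernel_inverse: "0 < sim_kernel l" "inverse (sim_kernel l) \<le> inverse \<rho>"
  using sim_kernel_ge[of l] Qt_bound(1) by (auto intro: le_imp_inverse_le)

lemma common_inner_le: "0 \<le> common_inner l" "common_inner l \<le> A * B ^ (\<tau> (Suc l) - \<tau> l)"
proof -
  show "0 \<le> common_inner l"
    using sim_kernel_inverse(1)[of l] inverse_one_minus_p0(1)[of l] p0_bounds(3)[of l]
    unfolding common_inner_def by (intro iffD2[OF inverse_nonnegative_iff_nonnegative] mult_nonneg_nonneg zero_le_power less_imp_le)
  have "inverse (p0 l) \<le> inverse (lt_min / lstar)"
    using p0_bounds(1) lt_bound(1) lstar_pos by (intro le_imp_inverse_le) auto
  \<comment> \<open>As \<open>B \<ge> 1\<close>, the exponent may be raised by one, which removes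
    the \<open>- 1\<close> and lets the exponents telescope later.\<close>
  moreover have "inverse ((1 - p0 l) ^ (\<tau> (Suc l) - \<tau> l - 1)) \<le> B ^ (\<tau> (Suc l) - \<tau> l)"
    using inverse_one_minus_p0(2)[of l] power_increasing[OF _ B_ge_1] by (meson diff_le_self order_trans)
  ultimately have "inverse (sim_kernel l) * (inverse (p0 l) * inverse ((1 - p0 l) ^ (\<tau> (Suc l) - \<tau> l - 1)))
      \<le> inverse \<rho> * (inverse (lt_min / lstar) * B ^ (\<tau> (Suc l) - \<tau> l))"
    using sim_kernel_inverse[of l] inverse_one_minus_p0(1)[of l] p0_bounds(3)[of l]
      Qt_bound(1) lt_bound(1) lstar_pos
    by (intro mult_mono mult_nonneg_nonneg)
      (simp_all only: less_imp_le inverse_nonnegative_iff_nonnegative zero_le_power divide_nonneg_pos)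
  then show "common_inner l \<le> A * B ^ (\<tau> (Suc l) - \<tau> l)"
    by (simp add: common_inner_def A_def divide_inverse inverse_mult_distrib mult_ac)
qed

lemma common_final_le: "0 \<le> common_final l" "common_final l \<le> A * B ^ (m - \<tau> l)"
proof -
  show "0 \<le> common_final l"
    using sim_kernel_inverse(1)[of l] inverse_one_minus_p0(1)[of l]
    unfolding common_final_def
    by (intro iffD2[OF inverse_nonnegative_iff_nonnegative] mult_nonneg_nonneg zero_le_power less_imp_le)
  \<comment> \<open>The last segment has no acceptance factor and costs only
    \<open>inverse \<rho>\<close>; this inequality absorbs that cost into \<open>A\<close>.\<close>
  have "lt_min \<le> lstar" using lt_bound(2) lt_bound(3)[of undefined] lt_bound(4)[of undefined] by linarith
  then have "inverse \<rho> * 1 \<le> inverse \<rho> * (lstar / lt_min)"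
    using Qt_bound(1) lt_bound(1) by (intro mult_left_mono) auto
  also have "\<dots> = A" by (simp add: A_def divide_inverse)
  finally have "inverse \<rho> \<le> A" by simp
  then have "inverse (sim_kernel l) \<le> A"
    using sim_kernel_inverse(2)[of l] by linarith
  then have "inverse (sim_kernel l) * inverse ((1 - p0 l) ^ (m - \<tau> l)) \<le> A * B ^ (m - \<tau> l)"
    using inverse_one_minus_p0[of l] A_ge_1 by (intro mult_mono) (auto simp: less_imp_le)
  then show "common_final l \<le> A * B ^ (m - \<tau> l)"
    by (simp add: common_final_def)
qed

text \<open>The exponents of \<open>B\<close> telescope, so that the bound is exponential in \<open>m\<close> rather than in
  \<open>m\<^sup>2\<close>; otherwise it would not be integrable.\<close>

lemma prod_common_inner_le: "(\<Prod>l<n. common_inner l) \<le> A ^ n * B ^ \<tau> n"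
proof (induction n)
  case (Suc n)
  have "(\<Prod>l<Suc n. common_inner l) \<le> (A ^ n * B ^ \<tau> n) * (A * B ^ (\<tau> (Suc n) - \<tau> n))"
    unfolding prod.lessThan_Suc
    using Suc common_inner_le A_ge_1 B_ge_1
    by (intro mult_mono) auto
  also have "\<dots> = A ^ Suc n * B ^ (\<tau> n + (\<tau> (Suc n) - \<tau> n))"
    by (simp only: power_add power_Suc mult_ac)
  finally show ?case using jump_index_Suc[of n] by simp
qed (simp add: jump_index_0)

lemma common_weight_le:
  assumes "\<tau> n \<le> m"
  shows "common_final n * (\<Prod>l<n. common_inner l) \<le> A ^ (m + 1) * B ^ m"
proof -
  have "common_final n * (\<Prod>l<n. common_inner l) \<le> (A * B ^ (m - \<tau> n)) * (A ^ n * B ^ \<tau> n)"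
    using common_final_le prod_common_inner_le common_inner_le(1) A_ge_1 B_ge_1
    by (intro mult_mono) (auto intro: prod_nonneg)
  also have "\<dots> = A ^ (n + 1) * B ^ (m - \<tau> n + \<tau> n)"
    by (simp add: power_add mult_ac)
  \<comment> \<open>The jump count \<open>n\<close> is replaced by the number of points
    \<open>m\<close>, whose law is known.\<close>
  also have "\<dots> \<le> A ^ (m + 1) * B ^ m"
    using assms index_le[OF assms] A_ge_1 B_ge_1
    by (intro mult_mono power_increasing) auto
  finally show ?thesis .
qed

section \<open>State and weight at time \<open>T\<close>, and the pathwise error bound\<close>

lemma last_jump_exists: "\<exists>n. \<tau> n \<le> m \<and> m < \<tau> (Suc n)"
proof -
  let ?S = "{n. \<tau> n \<le> m}"
  have fin: "finite ?S"
    using index_le by (auto intro: finite_subset[of _ "{..m}"])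
  have ne: "?S \<noteq> {}" using jump_index_0 by (auto intro: exI[of _ 0])
  have "Max ?S \<in> ?S" using fin ne by (rule Max_in)
  moreover have "Suc (Max ?S) \<notin> ?S" using Max_ge[OF fin, of "Suc (Max ?S)"] by auto
  ultimately show ?thesis by auto
qed

lemma jump_index_le_iff:
  assumes "\<tau> n \<le> m" "m < \<tau> (Suc n)"
  shows "\<tau> i \<le> m \<longleftrightarrow> i \<le> n"
  using assms strict_mono_less_eq[OF strict_mono_jump_index, of i n]
    strict_mono_less_eq[OF strict_mono_jump_index, of "Suc n" i] by linarith

text \<open>Stated for any characteristics \<open>d\<close> with the shared jump indices, so that it
  applies to both processes.\<close>

lemma jump_count_eq:
  assumes "\<tau> n \<le> m" "m < \<tau> (Suc n)" "jump_index K k lstar d x s = \<tau>"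
  shows "jump_count K k lstar d x s T = n"
proof -
  have "{i. 1 \<le> i \<and> pdp_time K k lstar d x s i \<le> T} = {1..n}"
    using jump_index_le_iff[OF assms(1,2)] Tstar_le_iff[of T] T
    by (auto simp: pdp_time_def assms(3))
  then show ?thesis by (simp add: jump_count_def)
qed

text \<open>In terms of point indices, the description of the current segment says that
  \<open>m\<close> lies between consecutive values of the strictly increasing \<open>\<tau>\<close>,
  which determines \<open>n\<close> uniquely.\<close>

lemma pdp_eq:
  assumes "\<tau> n \<le> m" "m < \<tau> (Suc n)" "jump_index K k lstar d x s = \<tau>"
  shows "pdp K k lstar d x s T = (mode K k lstar d x s n,
    flow d (mode K k lstar d x s n) (T - Tstar s (\<tau> n)) (position K k lstar d x s n))"
proof -
  have "(THE i. pdp_time K k lstar d x s i \<le> T \<and> T < pdp_time K k lstar d x s (Suc i)) = n"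
  proof (rule the_equality)
    show "pdp_time K k lstar d x s n \<le> T \<and> T < pdp_time K k lstar d x s (Suc n)"
      using assms Tstar_le_iff[of T] T by (auto simp: pdp_time_def not_le[symmetric])
  next
    fix i assume "pdp_time K k lstar d x s i \<le> T \<and> T < pdp_time K k lstar d x s (Suc i)"
    then have "\<tau> i \<le> m" "\<not> \<tau> (Suc i) \<le> m"
      using assms Tstar_le_iff[of T] T by (auto simp: pdp_time_def not_le[symmetric])
    then show "i = n" using jump_index_le_iff[OF assms(1,2)] by auto
  qed
  then show ?thesis
    using T by (simp add: pdp_def Let_def pdp_time_def assms(3))
qed

lemma weighted_functional_diff:
  assumes F_bound: "\<And>y. \<bar>F y\<bar> \<le> MF"
    and F_lipschitz: "0 < L_F" "\<And>\<theta>. L_F-lipschitz_on UNIV (\<lambda>\<nu>. F (\<theta>, \<nu>))"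
  shows "\<bar>F (pdp K k lstar c' x s T) * weight K k lstar c' x s lam Q T
           - F (pdp K k lstar c x s T) * weight K k lstar c x s lam Q T\<bar>
    \<le> A ^ (m + 1) * B ^ m * ((L_F + MF * ((real m + 2)\<^sup>2 * L)) * dev)"
proof -
  obtain n where n: "\<tau> n \<le> m" "m < \<tau> (Suc n)" using last_jump_exists by blast
  have eq: "jump_index K k lstar c' x s = \<tau>" using jump_index_coupled by auto
  define W where "W = common_final n * (\<Prod>l<n. common_inner l)"
  define G where "G = final \<nu> acc\<Phi> n * (\<Prod>l<n. inner \<nu> acc\<Phi> l)"
  define G' where "G' = final \<nu>' acc\<Psi> n * (\<Prod>l<n. inner \<nu>' acc\<Psi> l)"
  define f where "f = F (pdp K k lstar c x s T)"
  define f' where "f' = F (pdp K k lstar c' x s T)"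
  have w: "weight K k lstar c x s lam Q T = W * G" "weight K k lstar c' x s lam Q T = W * G'"
    unfolding weight_def Let_def jump_count_eq[OF n refl] jump_count_eq[OF n eq]
    by (simp_all add: Z_inner_eq Z_last_eq prod.distrib W_def G_def G'_def mult_ac)
  have W: "0 \<le> W" "W \<le> A ^ (m + 1) * B ^ m"
    using common_weight_le[OF n(1)] common_final_le(1) common_inner_le(1)
    by (auto simp: W_def intro!: mult_nonneg_nonneg prod_nonneg)
  have MF: "0 \<le> MF" using F_bound[of x] by linarith
  have abs_inner: "\<bar>\<Prod>l<n. inner v (acc K k lstar d x s lam) l\<bar> \<le> 1" for v d
    unfolding abs_prod using inner_abs_le by (intro prod_le_1) auto
  have G: "\<bar>G\<bar> \<le> 1" unfolding G_def abs_mult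
    using abs_inner final_abs_le by (intro mult_le_one) auto
  have le: "\<tau> (Suc l) \<le> m" if "l < n" for l
    using jump_index_le_iff[OF n] that by auto
  have "\<bar>G' - G\<bar> = \<bar>G - G'\<bar>" by simp
  \<comment> \<open>The final factor contributes once, and since \<open>n \<le> m\<close> there are
    at most \<open>m\<close> inner factors.\<close>
  also have "\<dots> \<le> (real m + 2) * (L * dev) + real m * ((real m + 2) * (L * dev))"
    unfolding G_def G'_def
    using final_abs_le abs_inner index_le[OF n(1)] inner_diff[OF le] inner_abs_le L_pos dev_nonneg
    by (intro order_trans[OF abs_mult_diff_le] add_mono final_diff n(1) abs_prod_diff_le) auto
  also have "\<dots> = (real m + 1) * ((real m + 2) * (L * dev))" by (simp add: algebra_simps)
  also have "\<dots> \<le> (real m + 2) * ((real m + 2) * (L * dev))"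
    using L_pos dev_nonneg by (intro mult_right_mono) auto
  finally have dG: "\<bar>G' - G\<bar> \<le> (real m + 2)\<^sup>2 * L * dev" by (simp add: power2_eq_square mult_ac)
  have t: "T - Tstar s (\<tau> n) \<in> {0..T}"
    using Tstar_le_iff[of T "\<tau> n"] T n(1) jump_time_nonneg[OF pois_unbounded, of "\<tau> n"] by auto
  let ?u = "\<Phi> (\<theta> n) (T - Tstar s (\<tau> n)) (\<nu> n)" and ?v = "\<Psi> (\<theta> n) (T - Tstar s (\<tau> n)) (\<nu>' n)"
  have "\<bar>f' - f\<bar> \<le> L_F * \<bar>?u - ?v\<bar>"
    unfolding f_def f'_def pdp_eq[OF n refl] pdp_eq[OF n eq] mode_coupled
    using lipschitz_onD[OF F_lipschitz(2), of ?v ?u "\<theta> n"] by (simp add: dist_real_def abs_minus_commute)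
  also have "\<dots> \<le> L_F * dev"
    using flow_dev[OF n(1) t] F_lipschitz(1) by (intro mult_left_mono) auto
  finally have df: "\<bar>f' - f\<bar> \<le> L_F * dev" .
  \<comment> \<open>The splitting pairs the weight error with the bounded \<open>f'\<close> and the
    error of \<open>F\<close> with \<open>G\<close>, which has modulus at most 1.\<close>
  have "f' * (W * G') - f * (W * G) = W * (f' * (G' - G) + (f' - f) * G)"
    by (simp add: algebra_simps)
  then have "\<bar>f' * (W * G') - f * (W * G)\<bar> = W * \<bar>f' * (G' - G) + (f' - f) * G\<bar>"
    using W(1) by (simp add: abs_mult)
  also have "\<dots> \<le> W * (\<bar>f'\<bar> * \<bar>G' - G\<bar> + \<bar>f' - f\<bar> * \<bar>G\<bar>)"
    using W(1) by (intro mult_left_mono) (metis abs_mult abs_triangle_ineq)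
  also have "\<dots> \<le> (A ^ (m + 1) * B ^ m) * (MF * ((real m + 2)\<^sup>2 * L * dev) + (L_F * dev) * 1)"
    using W G dG df F_bound MF F_lipschitz(1) dev_nonneg A_ge_1 B_ge_1
    by (intro mult_mono add_mono) (auto simp: f'_def)
  also have "\<dots> = A ^ (m + 1) * B ^ m * ((L_F + MF * ((real m + 2)\<^sup>2 * L)) * dev)"
    by (simp add: algebra_simps)
  finally show ?thesis by (simp add: w f_def f'_def)
qed

end

section \<open>Almost sure properties of the data\<close>

text \<open>By independence, \<open>n + 1\<close> consecutive variables all exceed \<open>c\<close>
  with probability \<open>(1 - c) ^ (n + 1)\<close>, which tends to 0.\<close>

lemma iid_uniform_AE_infinitely_often:
  assumes "prob_space M" "iid_uniform M U" "0 < c" "c \<le> 1"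
  shows "AE \<omega> in M. \<forall>m. \<exists>j>m. U j \<omega> \<le> c"
proof -
  interpret prob_space M by fact
  have ind: "indep_vars (\<lambda>_. borel) U {1..}"
    and dist: "\<And>i. 1 \<le> i \<Longrightarrow> distr M borel (U i) = uniform_measure lborel {0..1}"
    using assms(2) by (auto simp: iid_uniform_def)
  have meas: "U i \<in> borel_measurable M" if "1 \<le> i" for i
    using ind that by (auto simp: indep_vars_def)
  have prob_gt: "prob (U i -` {c<..} \<inter> space M) = 1 - c" if "1 \<le> i" for i
  proof -
    have "prob (U i -` {c<..} \<inter> space M) = measure (distr M borel (U i)) {c<..}"
      using meas[OF that] by (simp add: measure_distr)
    also have "\<dots> = measure lborel ({0..1} \<inter> {c<..}) / measure lborel {0..1::real}"
      unfolding dist[OF that] by (rule measure_uniform_measure) auto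
    also have "{0..1} \<inter> {c<..} = {c<..1::real}" using assms(3) by auto
    finally show ?thesis using assms(4) by simp
  qed
  have "AE \<omega> in M. \<exists>j>m. U j \<omega> \<le> c" for m
  proof -
    \<comment> \<open>Starting at \<open>Suc m\<close> also keeps the indices at least 1, where the
      law of \<open>U\<close> is prescribed.\<close>
    define D where "D = (\<lambda>n. \<Inter>i\<in>{Suc m..Suc (m + n)}. U i -` {c<..} \<inter> space M)"
    have prob_D: "prob (D n) = (1 - c) ^ Suc n" for n
    proof -
      have "prob (D n) = (\<Prod>i\<in>{Suc m..Suc (m + n)}. prob (U i -` {c<..} \<inter> space M))"
        unfolding D_def by (rule indep_varsD[OF ind]) auto
      also have "\<dots> = (\<Prod>i\<in>{Suc m..Suc (m + n)}. 1 - c)"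
        by (intro prod.cong) (auto simp: prob_gt)
      finally show ?thesis by simp
    qed
    define C where "C = (\<Inter>n. D n)"
    have setsD: "D n \<in> events" for n
      unfolding D_def using meas by (intro sets.finite_INT) auto
    then have setsC: "C \<in> events" unfolding C_def by auto
    have "prob C \<le> 0"
    proof (rule tendsto_lowerbound)
      show "(\<lambda>n. (1 - c) ^ Suc n) \<longlonglongrightarrow> 0"
        using assms(3,4) by (intro LIMSEQ_Suc LIMSEQ_realpow_zero) auto
      show "\<forall>\<^sub>F n in sequentially. prob C \<le> (1 - c) ^ Suc n"
      proof (intro always_eventually allI)
        fix n
        have "prob C \<le> prob (D n)"
          using setsD by (intro finite_measure_mono) (auto simp: C_def)
        then show "prob C \<le> (1 - c) ^ Suc n" by (simp add: prob_D)
      qed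
    qed simp
    then have "prob C = 0" using measure_nonneg[of M C] by linarith
    then have "C \<in> null_sets M" using setsC by (simp add: null_sets_def emeasure_eq_measure)
    then show ?thesis
      by (rule AE_I') (auto simp: C_def D_def not_le)
  qed
  then show ?thesis by (simp add: AE_all_countable)
qed

lemma poisson_process_marginal:
  assumes "poisson_process M r N" "0 < t"
  shows "distr M (count_space UNIV) (N t) = measure_pmf (poisson_pmf (r * t))"
proof -
  have "distr M (count_space UNIV) (N t) = distr M (count_space UNIV) (\<lambda>\<omega>. N t \<omega> - N 0 \<omega>)"
    using assms by (intro distr_cong) (auto simp: poisson_process_def)
  also have "\<dots> = measure_pmf (poisson_pmf (r * (t - 0)))"
    using assms unfolding poisson_process_def by blast
  finally show ?thesis by simp
qed

text \<open>The probability of fewer than \<open>j\<close> points is a finite sum of Poisson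
  weights, each of which vanishes as the mean grows.\<close>

lemma poisson_process_AE_unbounded:
  assumes "prob_space M" "poisson_process M r N" "0 < r"
  shows "AE \<omega> in M. \<forall>j. \<exists>t\<ge>0. j \<le> N t \<omega>"
proof -
  interpret prob_space M by fact
  have meas: "N t \<in> measurable M (count_space UNIV)" if "0 \<le> t" for t
    using assms(2) that by (auto simp: poisson_process_def)
  have "AE \<omega> in M. \<exists>t\<ge>0. j \<le> N t \<omega>" for j
  proof -
    \<comment> \<open>\<open>Suc n\<close> makes the time positive, as
      \<open>poisson_process_marginal\<close> requires.\<close>
    define D where "D = (\<lambda>n. N (real (Suc n)) -` {..<j} \<inter> space M)"
    have setsD: "D n \<in> events" for n
      unfolding D_def using meas[of "real (Suc n)"] by (auto intro: measurable_sets)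
    have prob_D: "prob (D n) = (\<Sum>i<j. (r * real (Suc n)) ^ i / fact i * exp (- (r * real (Suc n))))" for n
    proof -
      have "prob (D n) = measure (distr M (count_space UNIV) (N (real (Suc n)))) {..<j}"
        unfolding D_def using meas[of "real (Suc n)"] by (simp add: measure_distr)
      also have "\<dots> = measure (measure_pmf (poisson_pmf (r * real (Suc n)))) {..<j}"
        by (subst poisson_process_marginal[OF assms(2)]) auto
      also have "\<dots> = (\<Sum>i<j. pmf (poisson_pmf (r * real (Suc n))) i)"
        by (rule measure_measure_pmf_finite) simp
      finally show ?thesis using assms(3) by (simp add: mult_pos_pos del: of_nat_Suc)
    qed
    define C where "C = (\<Inter>n. D n)"
    have setsC: "C \<in> events" unfolding C_def using setsD by auto
    have "prob C \<le> 0"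
    proof (rule tendsto_lowerbound)
      have "filterlim (\<lambda>n. r * real (Suc n)) at_top sequentially"
        using assms(3)
        by (intro filterlim_tendsto_pos_mult_at_top[OF tendsto_const]
            filterlim_compose[OF filterlim_real_sequentially filterlim_Suc])
      moreover have "((\<lambda>y::real. y ^ i / fact i * exp (- y)) \<longlongrightarrow> 0) at_top" for i
        using tendsto_mult_right_zero[OF tendsto_power_div_exp_0[of i], of "inverse (fact i)"]
        by (simp add: exp_minus divide_inverse mult_ac)
      ultimately have "(\<lambda>n. (r * real (Suc n)) ^ i / fact i * exp (- (r * real (Suc n)))) \<longlonglongrightarrow> 0" for i
        by (rule filterlim_compose[rotated])
      then show "(\<lambda>n. \<Sum>i<j. (r * real (Suc n)) ^ i / fact i * exp (- (r * real (Suc n)))) \<longlonglongrightarrow> 0"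
        by (intro tendsto_null_sum) auto
      show "\<forall>\<^sub>F n in sequentially.
          prob C \<le> (\<Sum>i<j. (r * real (Suc n)) ^ i / fact i * exp (- (r * real (Suc n))))"
      proof (intro always_eventually allI)
        fix n
        have "prob C \<le> prob (D n)"
          using setsD by (intro finite_measure_mono) (auto simp: C_def)
        then show "prob C \<le> (\<Sum>i<j. (r * real (Suc n)) ^ i / fact i * exp (- (r * real (Suc n))))"
          by (simp add: prob_D)
      qed
    qed simp
    then have "prob C = 0" using measure_nonneg[of M C] by linarith
    then have "C \<in> null_sets M" using setsC by (simp add: null_sets_def emeasure_eq_measure)
    then show ?thesis
      by (rule AE_I') (auto simp: C_def D_def not_le simp del: of_nat_Suc, metis not_less of_nat_0_le_iff)
  qed
  then show ?thesis by (simp add: AE_all_countable)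
qed

section \<open>Integrability of the pathwise bound\<close>

text \<open>The probability generating function of the Poisson law, read off from the exponential
  series.\<close>

lemma nn_integral_poisson_power:
  assumes "0 < \<mu>" "0 \<le> r"
  shows "(\<integral>\<^sup>+n. ennreal (r ^ n) \<partial>measure_pmf (poisson_pmf \<mu>)) = ennreal (exp (\<mu> * (r - 1)))"
proof -
  have "(\<lambda>n. (\<mu> * r) ^ n / fact n) sums exp (\<mu> * r)"
    using exp_converges[of "\<mu> * r"] by (simp add: divide_inverse mult_ac)
  then have sums: "(\<lambda>n. (\<mu> * r) ^ n / fact n * exp (- \<mu>)) sums (exp (\<mu> * r) * exp (- \<mu>))"
    by (rule sums_mult2)
  have "(\<integral>\<^sup>+n. ennreal (r ^ n) \<partial>measure_pmf (poisson_pmf \<mu>))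
      = (\<Sum>n. ennreal ((\<mu> * r) ^ n / fact n * exp (- \<mu>)))"
    using assms
    by (simp add: nn_integral_measure_pmf nn_integral_count_space_nat ennreal_mult'[symmetric]
        power_mult_distrib mult_ac)
  also have "\<dots> = ennreal (exp (\<mu> * r) * exp (- \<mu>))"
    using sums assms by (intro sums_unique[symmetric] sums_ennreal[THEN iffD2]) auto
  also have "exp (\<mu> * r) * exp (- \<mu>) = exp (\<mu> * (r - 1))"
    by (simp add: exp_add[symmetric] algebra_simps)
  finally show ?thesis .
qed

lemma transition_measure_mode_prob_le:
  assumes "transition_measure Q"
  shows "mode_prob Q y A \<le> 1"
proof -
  have "Q y \<in> space (prob_algebra E_space)"
    using assms unfolding transition_measure_def
    by (intro measurable_space[of Q E_space]) (auto simp: E_space_def space_pair_measure)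
  then interpret prob_space "Q y" by (simp add: space_prob_algebra)
  show ?thesis by (simp add: mode_prob_def)
qed

text \<open>Turns the pathwise bound into a constant times a pure power, to which the generating
  function applies. The base 8 is \<open>4 * 2\<close>, coming from
  \<open>(m + 2)\<^sup>2 \<le> 4 * 4 ^ m\<close> and \<open>m + 1 \<le> 2 ^ m\<close>.\<close>

lemma polynomial_factors_le_exponential:
  fixes A B a L MF LF e :: real
  assumes "0 \<le> A" "0 \<le> B" "0 \<le> a" "0 \<le> L" "0 \<le> MF" "0 \<le> LF" "0 \<le> e"
  shows "A ^ (m + 1) * B ^ m * ((LF + MF * ((real m + 2)\<^sup>2 * L)) * (e * (real (m + 1) * a ^ (m + 1))))
    \<le> e * (A * a * (LF + 4 * MF * L)) * (A * B * a * 8) ^ m"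
proof -
  have le: "real (m + 1) \<le> 2 ^ m" by (induction m) auto
  then have "real m + 2 \<le> 2 * 2 ^ m" by simp
  then have "(real m + 2)\<^sup>2 \<le> (2 * 2 ^ m)\<^sup>2" by (intro power_mono) auto
  also have "(2 * 2 ^ m)\<^sup>2 = 4 * (4 :: real) ^ m"
    by (simp add: power_mult_distrib power2_eq_square flip: power_mult_distrib)
  finally have "LF * 1 + MF * ((real m + 2)\<^sup>2 * L) \<le> LF * 4 ^ m + MF * ((4 * 4 ^ m) * L)"
    using assms by (intro add_mono mult_left_mono mult_right_mono) auto
  also have "\<dots> = (LF + 4 * MF * L) * 4 ^ m" by (simp add: algebra_simps)
  finally have "(LF + MF * ((real m + 2)\<^sup>2 * L)) * (e * (real (m + 1) * a ^ (m + 1)))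
      \<le> ((LF + 4 * MF * L) * 4 ^ m) * (e * (2 ^ m * a ^ (m + 1)))"
    using le assms by (intro mult_mono mult_left_mono mult_right_mono) auto
  then have "A ^ (m + 1) * B ^ m * ((LF + MF * ((real m + 2)\<^sup>2 * L)) * (e * (real (m + 1) * a ^ (m + 1))))
      \<le> A ^ (m + 1) * B ^ m * (((LF + 4 * MF * L) * 4 ^ m) * (e * (2 ^ m * a ^ (m + 1))))"
    using assms by (intro mult_left_mono) auto
  also have "\<dots> = e * (A * a * (LF + 4 * MF * L)) * (A ^ m * B ^ m * a ^ m * (4 ^ m * 2 ^ m))"
    by (simp add: mult_ac)
  also have "A ^ m * B ^ m * a ^ m * (4 ^ m * 2 ^ m) = (A * B * a * 8) ^ m"
    using power_mult_distrib[of 4 "2 :: real" m] by (simp add: power_mult_distrib)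
  finally show ?thesis .
qed

section \<open>Passage from the pathwise bound to the mean square error\<close>

theorem theorem3p2:
  fixes K :: enat and k :: "nat \<Rightarrow> 'k::countable"
    and M :: "'w measure" and N :: "real \<Rightarrow> 'w \<Rightarrow> nat" and U V :: "nat \<Rightarrow> 'w \<Rightarrow> real"
    and lstar T C1 C2 L_lam L_Q L_F \<rho> lt_min lt_max :: real
    and x :: "'k \<times> real"
    and \<Phi> :: "'k \<Rightarrow> real \<Rightarrow> real \<Rightarrow> real"
    and \<Phi>bar :: "real \<Rightarrow> 'k \<Rightarrow> real \<Rightarrow> real \<Rightarrow> real"
    and lam lt :: "'k \<times> real \<Rightarrow> real"
    and Q Qt :: "'k \<times> real \<Rightarrow> ('k \<times> real) measure"
    and F :: "'k \<times> real \<Rightarrow> real"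
  assumes enum: "enumerates K k"
    and data: "thinning_data M lstar N U V"
    and T: "0 < T"
    and C: "0 < C1" "0 < C2"
    and scheme: "\<And>h \<theta> \<nu>1 \<nu>2 t. 0 < h \<Longrightarrow> t \<in> {0..T} \<Longrightarrow>
          \<bar>\<Phi> \<theta> t \<nu>1 - \<Phi>bar h \<theta> t \<nu>2\<bar> \<le> exp (C1 * T) * \<bar>\<nu>1 - \<nu>2\<bar> + C2 * h"
    and lam: "jump_intensity lam" "\<And>y. lam y \<le> lstar"
    and Q: "transition_measure Q"
    and lam_lipschitz: "0 < L_lam" "\<And>\<theta>. L_lam-lipschitz_on UNIV (\<lambda>\<nu>. lam (\<theta>, \<nu>))"
    and Q_lipschitz: "0 < L_Q" "\<And>\<theta> A. L_Q-lipschitz_on UNIV (\<lambda>\<nu>. mode_prob Q (\<theta>, \<nu>) A)"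
    and lt: "jump_intensity lt" "\<And>\<theta> \<nu> \<nu>'. lt (\<theta>, \<nu>) = lt (\<theta>, \<nu>')"
    and Qt: "transition_measure Qt" "\<And>\<theta> \<nu> \<nu>' A. mode_prob Qt (\<theta>, \<nu>) A = mode_prob Qt (\<theta>, \<nu>') A"
    and Qt_bound: "0 < \<rho>" "\<And>i j \<nu>. \<rho> \<le> mode_prob Qt (i, \<nu>) {j}"
    and lt_bound: "0 < lt_min" "0 < lt_max" "lt_max < lstar"
          "\<And>i \<nu>. lt_min \<le> lt (i, \<nu>) \<and> lt (i, \<nu>) \<le> lt_max"
    and F_bounded: "bounded (range F)"
    and F_lipschitz: "0 < L_F" "\<And>\<theta>. L_F-lipschitz_on UNIV (\<lambda>\<nu>. F (\<theta>, \<nu>))"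
  shows "\<exists>V1>0. \<forall>h>0.
     (let c = \<lparr>flow = \<Phi>, intensity = lt, kernel = Qt\<rparr>;
          cbar = \<lparr>flow = \<Phi>bar h, intensity = lt, kernel = Qt\<rparr>;
          s = realisation N U V;
          xt = (\<lambda>\<omega>. pdp K k lstar c x (s \<omega>) T);
          xt_bar = (\<lambda>\<omega>. pdp K k lstar cbar x (s \<omega>) T);
          R = (\<lambda>\<omega>. weight K k lstar c x (s \<omega>) lam Q T);
          R_bar = (\<lambda>\<omega>. weight K k lstar cbar x (s \<omega>) lam Q T)
      in (\<integral>\<^sup>+\<omega>. ennreal (\<bar>F (xt_bar \<omega>) * R_bar \<omega> - F (xt \<omega>) * R \<omega>\<bar>\<^sup>2) \<partial>M) \<le> ennreal (V1 * h\<^sup>2))"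
proof -
  have prob: "prob_space M" and pois: "poisson_process M lstar N" and unif: "iid_uniform M U"
    using data by (auto simp: thinning_data_def)
  obtain MF where MF: "\<And>y. \<bar>F y\<bar> \<le> MF"
    using F_bounded by (auto simp: bounded_iff)
  have MF0: "0 \<le> MF" using MF[of x] by linarith
  have lstar: "0 < lstar" "lt_min \<le> lstar"
    using lt_bound(2,3) lt_bound(4)[of undefined undefined] by linarith+
  define a where "a = exp (C1 * T)"
  \<comment> \<open>\<open>L0\<close>, \<open>A0\<close> and \<open>B0\<close> are the locale
    constants \<open>L\<close>, \<open>A\<close> and \<open>B\<close>, named before \<open>h\<close>
    and the path are fixed, so that \<open>V1\<close> can depend on neither.\<close>
  define L0 where "L0 = L_Q + L_lam / lstar"
  define A0 where "A0 = lstar / (\<rho> * lt_min)"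
  define B0 where "B0 = lstar / (lstar - lt_max)"
  \<comment> \<open>\<open>S\<close> and \<open>r\<close> are what
    \<open>polynomial_factors_le_exponential\<close> produces for \<open>e = C2 * h\<close>, with
    \<open>h\<close> taken out.\<close>
  define S where "S = C2 * (A0 * a * (L_F + 4 * MF * L0))"
  define r where "r = A0 * B0 * a * 8"
  have a: "1 \<le> a" using C T by (simp add: a_def)
  have L: "0 < L0" using Q_lipschitz(1) lam_lipschitz(1) lstar by (simp add: L0_def add_pos_pos)
  have AB: "0 < A0" "0 < B0" using lstar Qt_bound(1) lt_bound by (auto simp: A0_def B0_def)
  have S: "0 < S"
    unfolding S_def using C AB a F_lipschitz(1) MF0 L
    by (intro mult_pos_pos add_pos_nonneg) auto
  have r: "0 \<le> r" using AB a by (simp add: r_def)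
  \<comment> \<open>The exponential is the generating function of the Poisson law with mean
    \<open>lstar * T\<close> at \<open>r\<^sup>2\<close>, since the pathwise bound gets
    squared.\<close>
  define V1 where "V1 = S\<^sup>2 * exp (lstar * T * (r\<^sup>2 - 1))"
  have "0 < V1" using S by (simp add: V1_def)
  moreover have "(\<integral>\<^sup>+\<omega>. ennreal (\<bar>F (pdp K k lstar \<lparr>flow = \<Phi>bar h, intensity = lt, kernel = Qt\<rparr> x (realisation N U V \<omega>) T)
            * weight K k lstar \<lparr>flow = \<Phi>bar h, intensity = lt, kernel = Qt\<rparr> x (realisation N U V \<omega>) lam Q T
          - F (pdp K k lstar \<lparr>flow = \<Phi>, intensity = lt, kernel = Qt\<rparr> x (realisation N U V \<omega>) T)
            * weight K k lstar \<lparr>flow = \<Phi>, intensity = lt, kernel = Qt\<rparr> x (realisation N U V \<omega>) lam Q T\<bar>\<^sup>2) \<partial>M)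
        \<le> ennreal (V1 * h\<^sup>2)" (is "(\<integral>\<^sup>+\<omega>. ennreal (\<bar>?D \<omega>\<bar>\<^sup>2) \<partial>M) \<le> _")
    if h: "0 < h" for h
  proof -
    have bound: "\<bar>?D \<omega>\<bar> \<le> h * S * r ^ N T \<omega>"
      if \<omega>: "\<omega> \<in> space M" and U: "\<forall>m. \<exists>j>m. U j \<omega> \<le> lt_min / lstar"
        and N: "\<forall>j. \<exists>t\<ge>0. j \<le> N t \<omega>" for \<omega>
    proof -
      \<comment> \<open>Position 0 is the representative at which the position-free intensity and
        kernel are evaluated.\<close>
      interpret coupled_paths K k "realisation N U V \<omega>" lstar T a "C2 * h" L_lam L_Q \<rho> lt_min lt_max x
        \<Phi> "\<Phi>bar h" lam lt Q Qt "\<lambda>i. lt (i, 0)" "\<lambda>i. mode_prob Qt (i, 0)"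
      proof unfold_locales
        show "mono_on {0..} (pois (realisation N U V \<omega>))"
          using pois \<omega> by (auto simp: poisson_process_def realisation_def)
        show "\<exists>j>m. unifU (realisation N U V \<omega>) j * lstar \<le> lt_min" for m
          using U lstar by (auto simp: realisation_def pos_le_divide_eq)
        show "\<exists>t\<ge>0. j \<le> pois (realisation N U V \<omega>) t" for j
          using N by (simp add: realisation_def)
        show "continuous (at_right t) (pois (realisation N U V \<omega>))" if "0 \<le> t" for t
          using pois \<omega> that by (auto simp: poisson_process_def realisation_def)
        show "\<bar>\<Phi> \<theta> t \<nu>1 - \<Phi>bar h \<theta> t \<nu>2\<bar> \<le> a * \<bar>\<nu>1 - \<nu>2\<bar> + C2 * h" if "t \<in> {0..T}" for \<theta> t \<nu>1 \<nu>2
          using scheme[OF h that] by (simp add: a_def)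
        show "0 < lam y" for y using lam(1) by (cases y) (simp add: jump_intensity_def)
      qed (use T a C h lam(2) transition_measure_mode_prob_le[OF Q] lam_lipschitz Q_lipschitz
          lt(2) Qt(2) Qt_bound transition_measure_mode_prob_le[OF Qt(1)] lt_bound in auto)
      have pois_eq: "pois (realisation N U V \<omega>) T = N T \<omega>"
        by (simp add: realisation_def)
      have const_eq: "A = A0" "B = B0" "L = L0"
        by (simp_all only: A_def A0_def B_def B0_def L_def L0_def)
      have "\<bar>?D \<omega>\<bar> \<le> A0 ^ (N T \<omega> + 1) * B0 ^ N T \<omega> * ((L_F + MF * ((real (N T \<omega>) + 2)\<^sup>2 * L0))
          * (C2 * h * (real (N T \<omega> + 1) * a ^ (N T \<omega> + 1))))"
        using weighted_functional_diff[OF MF F_lipschitz] by (simp only: dev_def pois_eq const_eq)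
      also have "\<dots> \<le> (C2 * h) * (A0 * a * (L_F + 4 * MF * L0)) * (A0 * B0 * a * 8) ^ N T \<omega>"
        using AB a L MF0 F_lipschitz(1) C h by (intro polynomial_factors_le_exponential) auto
      also have "\<dots> = h * S * r ^ N T \<omega>" by (simp add: S_def r_def)
      finally show ?thesis .
    qed
    \<comment> \<open>A uniform variable below this threshold leads to acceptance in every
      mode.\<close>
    have "AE \<omega> in M. \<forall>m. \<exists>j>m. U j \<omega> \<le> lt_min / lstar"
      using lstar lt_bound(1) by (intro iid_uniform_AE_infinitely_often[OF prob unif]) auto
    moreover have "AE \<omega> in M. \<forall>j. \<exists>t\<ge>0. j \<le> N t \<omega>"
      by (rule poisson_process_AE_unbounded[OF prob pois lstar(1)])
    ultimately have "AE \<omega> in M. \<bar>?D \<omega>\<bar> \<le> h * S * r ^ N T \<omega>"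
      using AE_space by eventually_elim (rule bound)
    then have "AE \<omega> in M. ennreal (\<bar>?D \<omega>\<bar>\<^sup>2) \<le> ennreal (h\<^sup>2 * S\<^sup>2) * ennreal ((r\<^sup>2) ^ N T \<omega>)"
    proof eventually_elim
      case (elim \<omega>)
      have "\<bar>?D \<omega>\<bar>\<^sup>2 \<le> (h * S * r ^ N T \<omega>)\<^sup>2"
        using elim by (intro power_mono) auto
      also have "\<dots> = h\<^sup>2 * S\<^sup>2 * (r\<^sup>2) ^ N T \<omega>"
        by (simp add: power_mult_distrib power_mult[symmetric] mult.commute)
      finally show ?case by (simp add: ennreal_mult[symmetric])
    qed
    then have "(\<integral>\<^sup>+\<omega>. ennreal (\<bar>?D \<omega>\<bar>\<^sup>2) \<partial>M)
        \<le> (\<integral>\<^sup>+\<omega>. ennreal (h\<^sup>2 * S\<^sup>2) * ennreal ((r\<^sup>2) ^ N T \<omega>) \<partial>M)"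
      by (rule nn_integral_mono_AE)
    \<comment> \<open>The bound depends on the path only through \<open>N T\<close>, so the integral
      can be taken against its law.\<close>
    also have "\<dots> = (\<integral>\<^sup>+n. ennreal (h\<^sup>2 * S\<^sup>2) * ennreal ((r\<^sup>2) ^ n) \<partial>distr M (count_space UNIV) (N T))"
      using pois T by (intro nn_integral_distr[symmetric]) (auto simp: poisson_process_def)
    also have "\<dots> = ennreal (h\<^sup>2 * S\<^sup>2) * (\<integral>\<^sup>+n. ennreal ((r\<^sup>2) ^ n) \<partial>measure_pmf (poisson_pmf (lstar * T)))"
      unfolding poisson_process_marginal[OF pois T] by (rule nn_integral_cmult) simp
    also have "\<dots> = ennreal (h\<^sup>2 * S\<^sup>2) * ennreal (exp (lstar * T * (r\<^sup>2 - 1)))"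
      using lstar T by (subst nn_integral_poisson_power) auto
    also have "\<dots> = ennreal (V1 * h\<^sup>2)"
      by (simp add: V1_def ennreal_mult[symmetric] mult_ac)
    finally show ?thesis .
  qed
  ultimately show ?thesis
    unfolding Let_def by blast
qed


end
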